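(* Let $\mathfrak{g}$ be a $6$-dimensional nilpotent Lie algebra endowed with a complex structure $J$ for which there is a basis $\{\omega^j\}_{j=1}^3$ of $\mathfrak{g}^{1,0}$ satisfying $$d\omega^1=0,\qquad d\omega^2=\omega^{1\bar 1},\qquad d\omega^3=\rho\,\omega^{12}+B\,\omega^{1\bar 2}+C\,\omega^{2\bar 1},$$ with $\rho\in\{0,1\}$, $B,C\in\mathbb{C}$ and $(\rho,B,C)\neq(0,0,0)$. Then: (i) If $J$ is abelian, then there is a basis $\{\omega^j\}_{j=1}^3$ of $\mathfrak{g}^{1,0}$ satisfying either $$\text{(A)}\quad d\omega^1=0,\quad d\omega^2=\omega^{1\bar1},\quad d\omega^3=\omega^{2\bar 1},$$ or $$\text{(B)}\quad d\omega^1=0,\quad d\omega^2=\omega^{1\bar1},\quad d\omega^3=\omega^{1\bar 2}+c\,\omega^{2\bar 1},$$ where $c\in\mathbb{R}$, $c\ge 0$. (ii) If $J$ is not abelian, there is a basis $\{\omega^j\}_{j=1}^3$ of $\mathfrak{g}^{1,0}$ satisfying $$\text{(C)}\quad d\omega^1=0,\quad d\omega^2=\omega^{1\bar1},\quad d\omega^3=\omega^{12}+B\,\omega^{1\bar 2}+c\,\omega^{2\bar 1},$$ where $B\in\mathbb{C}$ and $c\in\mathbb{R}$ with $c\ge 0$. Moreover, for any possible choice of the parameters $B$ and $c$, each structure in (A), (B) and (C) defines an equivalence class of complex structures (i.e. distinct structures in the list (A), (B) with $c\ge0$, (C) with $B\in\mathbb{C}$, $c\ge 0$, are pairwise non-e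quivalent).
   Context: A complex structure on a real Lie algebra $\mathfrak{g}$ is an endomorphism $J$ with $J^2=-\mathrm{Id}$ and $[JX,JY]=J[JX,Y]+J[X,JY]+[X,Y]$ for all $X,Y$; it is abelian if $[JX,JY]=[X,Y]$ for all $X,Y\in\mathfrak{g}$, equivalently $d(\mathfrak{g}^{1,0})\subset\bigwedge^{1,1}(\mathfrak{g}^* )$ (for the equations above, equivalently $\rho=0$). $\mathfrak{g}^{1,0}\subset\mathfrak{g}_{\mathbb{C}}^*$ is the $i$-eigenspace of $J$ acting on $\mathfrak{g}_{\mathbb{C}}^*$; $d$ is the Chevalley–Eilenberg differential. Notation: $\omega^{jk}=\omega^j\wedge\omega^k$, $\omega^{j\bar k}=\omega^j\wedge\overline{\omega^k}$. Complex structures $J$ on $\mathfrak{g}$ and $J'$ on $\mathfrak{g}'$ are equivalent if there is a Lie algebra isomorphism $F:\mathfrak{g}\to\mathfrak{g}'$ with $F\circ J=J'\circ F$; equivalently, there is a $\mathbb{C}$-linear isomorphism between the spaces of $(1,0)$-forms whose extension (compatible with conjugation and wedge product) commutes with $d$. *)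

theory Defs
  imports "HOL-Analysis.Analysis" "HOL-Library.Function_Algebras"
begin

section \<open>Real Lie algebras with a complex structure\<close>

definition lie_bracket :: "('a::real_vector \<Rightarrow> 'a \<Rightarrow> 'a) \<Rightarrow> bool" where
  "lie_bracket br \<longleftrightarrow>
     bilinear br \<and>
     (\<forall>X. br X X = 0) \<and>
     (\<forall>X Y Z. br X (br Y Z) + br Y (br Z X) + br Z (br X Y) = 0)"

primrec lower_central_series :: "('a::real_vector \<Rightarrow> 'a \<Rightarrow> 'a) \<Rightarrow> nat \<Rightarrow> 'a set" where
  "lower_central_series br 0 = UNIV"
| "lower_central_series br (Suc k) = span {br X Y | X Y. Y \<in> lower_central_series br k}"

definition nilpotent_lie_bracket :: "('a::real_vector \<Rightarrow> 'a \<Rightarrow> 'a) \<Rightarrow> bool" where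
  "nilpotent_lie_bracket br \<longleftrightarrow> lie_bracket br \<and> (\<exists>k. lower_central_series br k = {0})"

definition complex_structure :: "('a::real_vector \<Rightarrow> 'a \<Rightarrow> 'a) \<Rightarrow> ('a \<Rightarrow> 'a) \<Rightarrow> bool" where
  "complex_structure br J \<longleftrightarrow>
     linear J \<and>
     (\<forall>X. J (J X) = - X) \<and>
     (\<forall>X Y. br (J X) (J Y) = J (br (J X) Y) + J (br X (J Y)) + br X Y)"

definition abelian_complex_structure :: "('a::real_vector \<Rightarrow> 'a \<Rightarrow> 'a) \<Rightarrow> ('a \<Rightarrow> 'a) \<Rightarrow> bool" where
  "abelian_complex_structure br J \<longleftrightarrow>
     complex_structure br J \<and> (\<forall>X Y. br (J X) (J Y) = br X Y)"

definition equivalent_complex_structures ::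
  "('a::real_vector \<Rightarrow> 'a \<Rightarrow> 'a) \<Rightarrow> ('a \<Rightarrow> 'a) \<Rightarrow>
   ('b::real_vector \<Rightarrow> 'b \<Rightarrow> 'b) \<Rightarrow> ('b \<Rightarrow> 'b) \<Rightarrow> bool" where
  "equivalent_complex_structures br J br' J' \<longleftrightarrow>
     (\<exists>F. linear F \<and> bij F \<and> (\<forall>X Y. F (br X Y) = br' (F X) (F Y)) \<and> F \<circ> J = J' \<circ> F)"

section \<open>Complex-valued forms\<close>

text \<open>
  The dual of the complexification of a real vector space is identified with the complex vector
  space of real-linear maps into the complex numbers, and its exterior square with the alternating
  real-bilinear maps into the complex numbers. Conjugation on both is then pointwise, and
  a \<open>J\<close> acts on a 1-form \<open>\<alpha>\<close> by \<open>\<alpha> \<circ> J\<close>.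
\<close>

definition form_scale :: "complex \<Rightarrow> ('a \<Rightarrow> complex) \<Rightarrow> 'a \<Rightarrow> complex" where
  "form_scale c \<alpha> = (\<lambda>X. c * \<alpha> X)"

global_interpretation forms: vector_space "form_scale :: complex \<Rightarrow> ('a \<Rightarrow> complex) \<Rightarrow> 'a \<Rightarrow> complex"
  by unfold_locales (auto simp: form_scale_def fun_eq_iff algebra_simps)

definition forms10 :: "('a::real_vector \<Rightarrow> 'a) \<Rightarrow> ('a \<Rightarrow> complex) set" where
  "forms10 J = {\<alpha>. linear \<alpha> \<and> (\<forall>X. \<alpha> (J X) = \<i> * \<alpha> X)}"

definition basis10 ::
  "('a::real_vector \<Rightarrow> 'a) \<Rightarrow> ('a \<Rightarrow> complex) \<Rightarrow> ('a \<Rightarrow> complex) \<Rightarrow> ('a \<Rightarrow> complex) \<Rightarrow> bool" where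
  "basis10 J \<omega>1 \<omega>2 \<omega>3 \<longleftrightarrow>
     distinct [\<omega>1, \<omega>2, \<omega>3] \<and>
     forms.independent {\<omega>1, \<omega>2, \<omega>3} \<and>
     forms.span {\<omega>1, \<omega>2, \<omega>3} = forms10 J"

definition form_cnj :: "('a \<Rightarrow> complex) \<Rightarrow> 'a \<Rightarrow> complex" where
  "form_cnj \<alpha> = (\<lambda>X. cnj (\<alpha> X))"

text \<open>The wedge product is normalised without the factor 1/2, matching the convention for the
  Chevalley--Eilenberg differential on 1-forms used here.\<close>

definition wedge :: "('a \<Rightarrow> complex) \<Rightarrow> ('a \<Rightarrow> complex) \<Rightarrow> 'a \<Rightarrow> 'a \<Rightarrow> complex" where
  "wedge \<alpha> \<beta> = (\<lambda>X Y. \<alpha> X * \<beta> Y - \<alpha> Y * \<beta> X)"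

definition ce_d :: "('a \<Rightarrow> 'a \<Rightarrow> 'a) \<Rightarrow> ('a \<Rightarrow> complex) \<Rightarrow> 'a \<Rightarrow> 'a \<Rightarrow> complex" where
  "ce_d br \<alpha> = (\<lambda>X Y. - \<alpha> (br X Y))"

definition structure_equations ::
  "('a \<Rightarrow> 'a \<Rightarrow> 'a) \<Rightarrow> ('a \<Rightarrow> complex) \<Rightarrow> ('a \<Rightarrow> complex) \<Rightarrow> ('a \<Rightarrow> complex) \<Rightarrow>
   complex \<Rightarrow> complex \<Rightarrow> complex \<Rightarrow> bool" where
  "structure_equations br \<omega>1 \<omega>2 \<omega>3 \<rho> B C \<longleftrightarrow>
     ce_d br \<omega>1 = (\<lambda>X Y. 0) \<and>
     ce_d br \<omega>2 = wedge \<omega>1 (form_cnj \<omega>1) \<and>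
     ce_d br \<omega>3 = (\<lambda>X Y. \<rho> * wedge \<omega>1 \<omega>2 X Y
                        + B * wedge \<omega>1 (form_cnj \<omega>2) X Y
                        + C * wedge \<omega>2 (form_cnj \<omega>1) X Y)"

definition admits_equations ::
  "('a::real_vector \<Rightarrow> 'a \<Rightarrow> 'a) \<Rightarrow> ('a \<Rightarrow> 'a) \<Rightarrow> complex \<Rightarrow> complex \<Rightarrow> complex \<Rightarrow> bool" where
  "admits_equations br J \<rho> B C \<longleftrightarrow>
     (\<exists>\<omega>1 \<omega>2 \<omega>3. basis10 J \<omega>1 \<omega>2 \<omega>3 \<and> structure_equations br \<omega>1 \<omega>2 \<omega>3 \<rho> B C)"

text \<open>
  Coefficient triples \<open>(\<rho>, B, C)\<close> of the normal forms: one structure (A), the family (B) with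
  parameter \<open>c \<ge> 0\<close> and the family (C) with parameters \<open>B\<close> and \<open>c \<ge> 0\<close>. Different members of
  the list have different triples.
\<close>

definition normal_forms :: "(complex \<times> complex \<times> complex) set" where
  "normal_forms =
     {(0, 0, 1)}
     \<union> {(0, 1, of_real c) | c::real. c \<ge> 0}
     \<union> {(1, B, of_real c) | (B::complex) (c::real). c \<ge> 0}"

end

theory Submission
  imports Defs
begin

text \<open>
  A basis of (1,0)-forms is the same as a real-linear isomorphism onto complex 3-space that turns
  \<open>J\<close> into multiplication by \<open>\<i>\<close>, so every identity can be checked in coordinates. For
  a unit number \<open>v\<close> and \<open>u \<noteq> 0\<close> the change \<open>(\<omega>1, \<omega>2, \<omega>3) \<mapsto> (v \<omega>1, \<omega>2, u v \<omega>3)\<close> replaces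
  \<open>(\<rho>, B, C)\<close> by \<open>(u \<rho>, u B, u v\<^sup>2 C)\<close>; choosing \<open>u\<close> to normalise \<open>\<rho>\<close> or \<open>B\<close> and \<open>v\<close>
  to rotate \<open>C\<close> onto the nonnegative half-line gives the reduction. Conversely, comparing
  coefficients shows that any two adapted bases satisfy \<open>\<sigma>1 = a \<omega>1\<close> and
  \<open>\<sigma>2 \<equiv> \<bar>a\<bar>\<^sup>2 \<omega>2\<close> modulo \<open>\<omega>1\<close>, and that up to a common factor their triples are related by
  \<open>(\<rho>', B', C') \<sim> (\<rho>, B, a C / cnj a)\<close>, which is the identity on normal forms.
\<close>

section \<open>Coframes of type (1,0)\<close>

definition coords :: "('a \<Rightarrow> complex) \<Rightarrow> ('a \<Rightarrow> complex) \<Rightarrow> ('a \<Rightarrow> complex) \<Rightarrow> 'a \<Rightarrow> complex \<times> complex \<times> complex"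
  where "coords \<omega>1 \<omega>2 \<omega>3 X = (\<omega>1 X, \<omega>2 X, \<omega>3 X)"

text \<open>One bijection in place of independence and span: injectivity reduces an equation between
  vectors to three scalar equations, and surjectivity supplies vectors with prescribed
  coordinates.\<close>

definition coframe10 ::
  "('a::real_vector \<Rightarrow> 'a) \<Rightarrow> ('a \<Rightarrow> complex) \<Rightarrow> ('a \<Rightarrow> complex) \<Rightarrow> ('a \<Rightarrow> complex) \<Rightarrow> bool" where
  "coframe10 J \<omega>1 \<omega>2 \<omega>3 \<longleftrightarrow>
     \<omega>1 \<in> forms10 J \<and> \<omega>2 \<in> forms10 J \<and> \<omega>3 \<in> forms10 J \<and> bij (coords \<omega>1 \<omega>2 \<omega>3)"

lemma linear_coords:
  assumes "linear \<omega>1" "linear \<omega>2" "linear \<omega>3"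
  shows "linear (coords \<omega>1 \<omega>2 \<omega>3)"
  by (rule linearI) (simp_all add: coords_def assms linear_add linear_scale)

lemma coframe10_eqI:
  assumes "coframe10 J \<omega>1 \<omega>2 \<omega>3" "\<omega>1 X = \<omega>1 Y" "\<omega>2 X = \<omega>2 Y" "\<omega>3 X = \<omega>3 Y"
  shows "X = Y"
proof -
  have "inj (coords \<omega>1 \<omega>2 \<omega>3)"
    using assms(1) by (simp add: coframe10_def bij_is_inj)
  then show ?thesis
    by (rule injD) (simp add: coords_def assms)
qed

lemma coframe10_obtain:
  assumes "coframe10 J \<omega>1 \<omega>2 \<omega>3"
  obtains X where "\<omega>1 X = x" "\<omega>2 X = y" "\<omega>3 X = z"
proof -
  have "surj (coords \<omega>1 \<omega>2 \<omega>3)"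
    using assms by (simp add: coframe10_def bij_def)
  then obtain X where "(x, y, z) = coords \<omega>1 \<omega>2 \<omega>3 X"
    by (rule surjE)
  then show thesis using that by (simp add: coords_def)
qed

lemma forms10_linear: "\<alpha> \<in> forms10 J \<Longrightarrow> linear \<alpha>"
  and forms10_J: "\<alpha> \<in> forms10 J \<Longrightarrow> \<alpha> (J X) = \<i> * \<alpha> X"
  by (auto simp: forms10_def)

lemma linear_form_scale: "linear \<alpha> \<Longrightarrow> linear (\<lambda>X. c * \<alpha> X)" for \<alpha> :: "'a::real_vector \<Rightarrow> complex"
  by (rule linearI) (simp_all add: linear_add linear_scale algebra_simps)

lemma forms10_scale: "\<alpha> \<in> forms10 J \<Longrightarrow> (\<lambda>X. c * \<alpha> X) \<in> forms10 J"
  by (simp add: forms10_def linear_form_scale)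

lemma forms10_subspace: "forms.subspace (forms10 J)"
proof (rule forms.subspaceI)
  show "0 \<in> forms10 J"
    by (auto simp: forms10_def intro!: linearI)
  show "x + y \<in> forms10 J" if "x \<in> forms10 J" "y \<in> forms10 J" for x y
    using that by (auto simp: forms10_def linear_add linear_scale algebra_simps intro!: linearI)
  show "form_scale c x \<in> forms10 J" if "x \<in> forms10 J" for c x
    using that by (simp add: form_scale_def forms10_scale)
qed

lemma forms_span_three:
  "\<alpha> \<in> forms.span {\<omega>1, \<omega>2, \<omega>3} \<longleftrightarrow> (\<exists>a b c. \<alpha> = (\<lambda>X. a * \<omega>1 X + b * \<omega>2 X + c * \<omega>3 X))"
proof -
  have "\<alpha> \<in> forms.span {\<omega>1, \<omega>2, \<omega>3} \<longleftrightarrow>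
      (\<exists>a b c. \<alpha> - form_scale a \<omega>1 - form_scale b \<omega>2 - form_scale c \<omega>3 = 0)"
    by (simp add: forms.span_insert)
  also have "\<dots> \<longleftrightarrow> (\<exists>a b c. \<alpha> = (\<lambda>X. a * \<omega>1 X + b * \<omega>2 X + c * \<omega>3 X))"
    by (simp add: form_scale_def fun_eq_iff algebra_simps)
  finally show ?thesis .
qed

section \<open>Bases of (1,0)-forms as complex coordinate systems\<close>

lemma forms10_separate:
  fixes X :: "'a::real_vector"
  assumes J: "linear J" "\<And>X. J (J X) = - X" and "X \<noteq> 0"
  shows "\<exists>\<alpha>\<in>forms10 J. \<alpha> X \<noteq> 0"
proof -
  have "independent {X}" using \<open>X \<noteq> 0\<close> by simp
  then obtain f :: "'a \<Rightarrow> real" where f: "linear f" "f X = 1"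
    using linear_independent_extend[of "{X}" "\<lambda>_. 1"] by auto
  \<comment> \<open>Twice the (1,0)-part of the real functional \<open>f\<close>. Its real part is
    \<open>f\<close>, so it cannot vanish at \<open>X\<close>.\<close>
  let ?\<alpha> = "\<lambda>Y. complex_of_real (f Y) - \<i> * complex_of_real (f (J Y))"
  note lins = linear_add[OF J(1)] linear_scale[OF J(1)]
    linear_add[OF f(1)] linear_scale[OF f(1)]
  have "linear ?\<alpha>"
    by (rule linearI) (simp_all add: lins algebra_simps scaleR_conv_of_real)
  moreover have "?\<alpha> (J Y) = \<i> * ?\<alpha> Y" for Y
    by (simp add: J(2) linear_neg[OF f(1)] algebra_simps)
  ultimately have "?\<alpha> \<in> forms10 J"
    unfolding forms10_def by (intro CollectI conjI allI)
  moreover have "?\<alpha> X \<noteq> 0"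
    using f(2) by (auto dest: arg_cong[where f = Re])
  ultimately show ?thesis
    by (intro bexI[where x = ?\<alpha>])
qed

text \<open>The domain is an abstract real vector space known only through its dimension. The image
  of a basis is independent and has \<open>DIM('b)\<close> elements, so it already spans the
  target.\<close>

lemma inj_linear_surj_of_dim:
  fixes f :: "'a::real_vector \<Rightarrow> 'b::euclidean_space"
  assumes "linear f" "inj f" and dim: "dim (UNIV :: 'a set) = DIM('b)"
  shows "surj f"
proof -
  obtain B :: "'a set" where B: "independent B" "span B = UNIV" "card B = DIM('b)"
    using basis_exists[of "UNIV :: 'a set"] dim by (metis UNIV_I subset_UNIV subset_antisym)
  have "independent (f ` B)"
    using B(1) assms by (metis linear_independent_injective_image subset_UNIV inj_on_subset)
  moreover have "card (f ` B) = DIM('b)"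
    using B(3) \<open>inj f\<close> by (metis card_image inj_on_subset subset_UNIV)
  ultimately have "span (f ` B) = UNIV"
    using card_ge_dim_independent[of "f ` B" UNIV] by auto
  then show ?thesis
    using linear_span_image[OF \<open>linear f\<close>, of B] B(2) by simp
qed

lemma linear_bij_of_dim:
  assumes dim: "dim (UNIV :: 'a::real_vector set) = DIM('b::euclidean_space)"
  shows "\<exists>f :: 'a \<Rightarrow> 'b. linear f \<and> bij f"
proof -
  obtain B :: "'a set" where B: "independent B" "span B = UNIV" "card B = DIM('b)"
    using basis_exists[of "UNIV :: 'a set"] dim by (metis UNIV_I subset_UNIV subset_antisym)
  \<comment> \<open>An infinite set has cardinality 0 by convention, so a positive cardinality
    certifies finiteness.\<close>
  have "finite B" using B(3) card_ge_0_finite DIM_positive by metis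
  then obtain b where b: "bij_betw b B (Basis :: 'b set)"
    using B(3) finite_same_card_bij finite_Basis by metis
  obtain f where f: "linear f" "\<And>x. x \<in> B \<Longrightarrow> f x = b x"
    using linear_independent_extend[OF B(1), of b] by auto
  have im: "f ` B = Basis" and "inj_on f B"
    using b f(2) by (auto simp: bij_betw_def inj_on_def image_def)
  then have "inj f"
    using linear_inj_on_span_independent_image[OF f(1), of B] B(2) independent_Basis by metis
  then show ?thesis
    using f(1) inj_linear_surj_of_dim dim by (auto simp: bij_def)
qed

text \<open>A vector killed by a spanning triple is killed by every (1,0)-form, hence is zero;
  counting dimensions turns this injectivity into bijectivity. Conversely, the vectors dual to a
  coframe read off the coefficients of any (1,0)-form.\<close>

lemma basis10_iff_coframe10:
  fixes J :: "'a::real_vector \<Rightarrow> 'a"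
  assumes dim: "dim (UNIV :: 'a set) = 6" and J: "linear J" "\<And>X. J (J X) = - X"
  shows "basis10 J \<omega>1 \<omega>2 \<omega>3 \<longleftrightarrow> coframe10 J \<omega>1 \<omega>2 \<omega>3"
proof
  assume "basis10 J \<omega>1 \<omega>2 \<omega>3"
  then have span: "forms.span {\<omega>1, \<omega>2, \<omega>3} = forms10 J" by (simp add: basis10_def)
  then have \<omega>: "\<omega>1 \<in> forms10 J" "\<omega>2 \<in> forms10 J" "\<omega>3 \<in> forms10 J"
    using forms.span_superset[of "{\<omega>1, \<omega>2, \<omega>3}"] by auto
  have lin: "linear (coords \<omega>1 \<omega>2 \<omega>3)"
    by (intro linear_coords \<omega>[THEN forms10_linear])
  have "X = 0" if "coords \<omega>1 \<omega>2 \<omega>3 X = 0" for X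
  proof (rule ccontr)
    assume "X \<noteq> 0"
    then obtain \<alpha> where "\<alpha> \<in> forms10 J" "\<alpha> X \<noteq> 0"
      using forms10_separate[OF J] by blast
    then show False
      using that unfolding span[symmetric] forms_span_three by (auto simp: coords_def zero_prod_def)
  qed
  then have "inj (coords \<omega>1 \<omega>2 \<omega>3)"
    using lin by (simp add: linear_injective_0)
  then show "coframe10 J \<omega>1 \<omega>2 \<omega>3"
    using inj_linear_surj_of_dim[OF lin] dim \<omega> by (simp add: coframe10_def bij_def)
next
  assume cf: "coframe10 J \<omega>1 \<omega>2 \<omega>3"
  then have \<omega>: "\<omega>1 \<in> forms10 J" "\<omega>2 \<in> forms10 J" "\<omega>3 \<in> forms10 J"
    by (simp_all add: coframe10_def)
  \<comment> \<open>The dual vectors: evaluating a combination of the three forms at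
    \<open>X1\<close>, \<open>X2\<close>, \<open>X3\<close> isolates its coefficients.\<close>
  obtain X1 where X1: "\<omega>1 X1 = 1" "\<omega>2 X1 = 0" "\<omega>3 X1 = 0" using coframe10_obtain[OF cf] .
  obtain X2 where X2: "\<omega>1 X2 = 0" "\<omega>2 X2 = 1" "\<omega>3 X2 = 0" using coframe10_obtain[OF cf] .
  obtain X3 where X3: "\<omega>1 X3 = 0" "\<omega>2 X3 = 0" "\<omega>3 X3 = 1" using coframe10_obtain[OF cf] .
  have dist: "distinct [\<omega>1, \<omega>2, \<omega>3]"
    using X1 X2 by auto
  have indep: "forms.independent {\<omega>1, \<omega>2, \<omega>3}"
  proof
    assume "forms.dependent {\<omega>1, \<omega>2, \<omega>3}"
    then obtain u where u: "\<exists>v\<in>{\<omega>1, \<omega>2, \<omega>3}. u v \<noteq> 0"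
        and "(\<Sum>v\<in>{\<omega>1, \<omega>2, \<omega>3}. form_scale (u v) v) = 0"
      by (auto simp: forms.dependent_finite)
    then have "u \<omega>1 * \<omega>1 X + (u \<omega>2 * \<omega>2 X + u \<omega>3 * \<omega>3 X) = 0" for X
      using dist by (simp add: form_scale_def fun_eq_iff)
    from this[of X1] this[of X2] this[of X3] u show False
      by (auto simp: X1 X2 X3)
  qed
  have "\<alpha> \<in> forms.span {\<omega>1, \<omega>2, \<omega>3}" if \<alpha>: "\<alpha> \<in> forms10 J" for \<alpha>
  proof -
    have "\<alpha> X = \<alpha> X1 * \<omega>1 X + \<alpha> X2 * \<omega>2 X + \<alpha> X3 * \<omega>3 X" for X
    proof -
      \<comment> \<open>complex multiplication on \<open>'a\<close> with \<open>J\<close> in the role of the imaginary unit\<close>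
      define smul where "smul z Z = Re z *\<^sub>R Z + Im z *\<^sub>R J Z" for z Z
      have smul: "\<beta> (smul z Z) = z * \<beta> Z" if "\<beta> \<in> forms10 J" for \<beta> z Z
        using forms10_linear[OF that] forms10_J[OF that]
        by (simp add: smul_def linear_add linear_scale complex_eq_iff)
      have "X = smul (\<omega>1 X) X1 + smul (\<omega>2 X) X2 + smul (\<omega>3 X) X3"
        by (rule coframe10_eqI[OF cf])
          (simp_all add: \<omega>[THEN forms10_linear, THEN linear_add] \<omega>[THEN smul] X1 X2 X3)
      then have "\<alpha> X = \<alpha> (smul (\<omega>1 X) X1 + smul (\<omega>2 X) X2 + smul (\<omega>3 X) X3)"
        by (rule arg_cong)
      also have "\<dots> = \<alpha> X1 * \<omega>1 X + \<alpha> X2 * \<omega>2 X + \<alpha> X3 * \<omega>3 X"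
        by (simp add: linear_add[OF forms10_linear[OF \<alpha>]] smul[OF \<alpha>])
      finally show ?thesis .
    qed
    then show ?thesis unfolding forms_span_three by blast
  qed
  moreover have "forms.span {\<omega>1, \<omega>2, \<omega>3} \<subseteq> forms10 J"
    using forms10_subspace \<omega> by (intro forms.span_minimal) auto
  ultimately show "basis10 J \<omega>1 \<omega>2 \<omega>3"
    using dist indep by (auto simp: basis10_def)
qed

section \<open>The structure equations in coordinates\<close>

text \<open>The minus sign of \<open>ce_d\<close> is moved to the right, so that each coordinate of
  a bracket becomes an explicit polynomial in the coordinates of \<open>X\<close> and
  \<open>Y\<close> and their conjugates.\<close>

lemma structure_equations_iff:
  "structure_equations br \<omega>1 \<omega>2 \<omega>3 \<rho> B C \<longleftrightarrow>
     (\<forall>X Y. \<omega>1 (br X Y) = 0 \<and>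
        \<omega>2 (br X Y) = \<omega>1 Y * cnj (\<omega>1 X) - \<omega>1 X * cnj (\<omega>1 Y) \<and>
        \<omega>3 (br X Y) = \<rho> * (\<omega>1 Y * \<omega>2 X - \<omega>1 X * \<omega>2 Y)
          + B * (\<omega>1 Y * cnj (\<omega>2 X) - \<omega>1 X * cnj (\<omega>2 Y))
          + C * (\<omega>2 Y * cnj (\<omega>1 X) - \<omega>2 X * cnj (\<omega>1 Y)))"
proof -
  have neg: "- u = v \<longleftrightarrow> u = - v" for u v :: complex by auto
  show ?thesis
    unfolding structure_equations_def ce_d_def wedge_def form_cnj_def fun_eq_iff neg
    by (auto simp: algebra_simps)
qed

lemma structure_equationsD:
  assumes "structure_equations br \<omega>1 \<omega>2 \<omega>3 \<rho> B C"
  shows "\<omega>1 (br X Y) = 0"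
    and "\<omega>2 (br X Y) = \<omega>1 Y * cnj (\<omega>1 X) - \<omega>1 X * cnj (\<omega>1 Y)"
    and "\<omega>3 (br X Y) = \<rho> * (\<omega>1 Y * \<omega>2 X - \<omega>1 X * \<omega>2 Y)
          + B * (\<omega>1 Y * cnj (\<omega>2 X) - \<omega>1 X * cnj (\<omega>2 Y))
          + C * (\<omega>2 Y * cnj (\<omega>1 X) - \<omega>2 X * cnj (\<omega>1 Y))"
  using assms unfolding structure_equations_iff by blast+

section \<open>The algebra determined by the equations, and its realisation\<close>

text \<open>The equations are triangular: \<open>\<omega>1\<close> kills brackets,
  \<open>\<omega>2\<close> of a bracket sees only \<open>\<omega>1\<close>, and
  \<open>\<omega>3\<close> of a bracket sees only \<open>\<omega>1\<close> and
  \<open>\<omega>2\<close>. Each step of the lower central series therefore kills one more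
  coordinate, and the third term is zero.\<close>

lemma structure_equations_nilpotent:
  assumes cf: "coframe10 J \<omega>1 \<omega>2 \<omega>3" and se: "structure_equations br \<omega>1 \<omega>2 \<omega>3 \<rho> B C"
  shows "nilpotent_lie_bracket br"
proof -
  note br = structure_equationsD[OF se]
  have lin: "linear \<omega>1" "linear \<omega>2" "linear \<omega>3"
    using cf by (auto simp: coframe10_def forms10_def)
  note lins = linear_add[OF lin(1)] linear_add[OF lin(2)] linear_add[OF lin(3)]
    linear_scale[OF lin(1)] linear_scale[OF lin(2)] linear_scale[OF lin(3)]
    linear_0[OF lin(1)] linear_0[OF lin(2)] linear_0[OF lin(3)]
  have bil: "bilinear br"
    unfolding bilinear_def
    by (auto intro!: linearI coframe10_eqI[OF cf] simp: br lins algebra_simps scaleR_conv_of_real)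
  have alt: "br X X = 0" for X
    by (rule coframe10_eqI[OF cf]) (simp_all add: br lins)
  \<comment> \<open>Only the third coordinate is nontrivial. Since \<open>\<omega>2\<close> of a
    bracket is purely imaginary, each coefficient there multiplies, up to sign, a 3 by 3 determinant
    with rows taken from \<open>\<omega>1\<close> and its conjugate, two of them equal.\<close>
  have jac: "br X (br Y Z) + br Y (br Z X) + br Z (br X Y) = 0" for X Y Z
    by (rule coframe10_eqI[OF cf]) (simp_all add: br lins, algebra)
  have sub: "subspace {X. \<omega>1 X = 0}" "subspace {X. \<omega>1 X = 0 \<and> \<omega>2 X = 0}"
    by (auto simp: subspace_def lins)
  have l1: "lower_central_series br (Suc 0) \<subseteq> {X. \<omega>1 X = 0}"
    unfolding lower_central_series.simps by (rule span_minimal[OF _ sub(1)]) (auto simp: br)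
  have l2: "lower_central_series br (Suc (Suc 0)) \<subseteq> {X. \<omega>1 X = 0 \<and> \<omega>2 X = 0}"
    unfolding lower_central_series.simps(2)[of _ "Suc 0"]
    by (rule span_minimal[OF _ sub(2)]) (use l1 in \<open>auto simp: br\<close>)
  have "br X Y = 0" if "Y \<in> lower_central_series br (Suc (Suc 0))" for X Y
    by (rule coframe10_eqI[OF cf]) (use that l2 in \<open>auto simp: br lins\<close>)
  then have "{br X Y |X Y. Y \<in> lower_central_series br (Suc (Suc 0))} \<subseteq> {0}"
    by blast
  then have "lower_central_series br (Suc (Suc (Suc 0))) \<subseteq> {0}"
    unfolding lower_central_series.simps(2)[of _ "Suc (Suc 0)"]
    by (rule span_minimal) (simp add: subspace_def)
  moreover have "0 \<in> lower_central_series br (Suc (Suc (Suc 0)))"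
    by (simp only: lower_central_series.simps span_zero)
  ultimately have "lower_central_series br (Suc (Suc (Suc 0))) = {0}" by blast
  then show ?thesis
    unfolding nilpotent_lie_bracket_def lie_bracket_def using bil alt jac by blast
qed

text \<open>Integrability says that differentials of (1,0)-forms have no (0,2)-component, and the
  right-hand sides contain only (2,0)- and (1,1)-terms.\<close>

lemma structure_equations_complex_structure:
  assumes cf: "coframe10 J \<omega>1 \<omega>2 \<omega>3" and se: "structure_equations br \<omega>1 \<omega>2 \<omega>3 \<rho> B C"
  shows "complex_structure br J"
proof -
  note br = structure_equationsD[OF se]
  have \<omega>: "\<omega>1 \<in> forms10 J" "\<omega>2 \<in> forms10 J" "\<omega>3 \<in> forms10 J"
    using cf by (auto simp: coframe10_def)
  note lin = \<omega>[THEN forms10_linear]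
  note lins = linear_add[OF lin(1)] linear_add[OF lin(2)] linear_add[OF lin(3)]
    linear_scale[OF lin(1)] linear_scale[OF lin(2)] linear_scale[OF lin(3)]
    linear_neg[OF lin(1)] linear_neg[OF lin(2)] linear_neg[OF lin(3)] \<omega>[THEN forms10_J]
  have "linear J"
    by (auto intro!: linearI coframe10_eqI[OF cf] simp: lins algebra_simps)
  moreover have "J (J X) = - X" for X
    by (rule coframe10_eqI[OF cf]) (simp_all add: lins)
  moreover have "br (J X) (J Y) = J (br (J X) Y) + J (br X (J Y)) + br X Y" for X Y
    by (rule coframe10_eqI[OF cf]) (simp_all add: br lins algebra_simps)
  ultimately show ?thesis by (simp add: complex_structure_def)
qed

text \<open>The coordinates of \<open>J X\<close> and \<open>br X Y\<close> are prescribed by the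
  equations and pulled back along a real-linear isomorphism with complex 3-space; the preceding
  lemmas then give the axioms.\<close>

lemma exists_complex_structure_admitting:
  assumes dim: "dim (UNIV :: 'a::real_vector set) = 6"
  shows "\<exists>(br :: 'a \<Rightarrow> 'a \<Rightarrow> 'a) J.
    nilpotent_lie_bracket br \<and> complex_structure br J \<and> admits_equations br J \<rho> B C"
proof -
  obtain \<Phi> :: "'a \<Rightarrow> complex \<times> complex \<times> complex" where \<Phi>: "linear \<Phi>" "bij \<Phi>"
    using linear_bij_of_dim[where 'a = 'a and 'b = "complex \<times> complex \<times> complex"] dim by auto
  define \<omega>1 where "\<omega>1 = (\<lambda>X. fst (\<Phi> X))"
  define \<omega>2 where "\<omega>2 = (\<lambda>X. fst (snd (\<Phi> X)))"
  define \<omega>3 where "\<omega>3 = (\<lambda>X. snd (snd (\<Phi> X)))"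
  note \<omega>_defs = \<omega>1_def \<omega>2_def \<omega>3_def
  define J where "J = (\<lambda>X. inv \<Phi> (\<i> * \<omega>1 X, \<i> * \<omega>2 X, \<i> * \<omega>3 X))"
  define br where "br = (\<lambda>X Y. inv \<Phi> (0, \<omega>1 Y * cnj (\<omega>1 X) - \<omega>1 X * cnj (\<omega>1 Y),
      \<rho> * (\<omega>1 Y * \<omega>2 X - \<omega>1 X * \<omega>2 Y)
          + B * (\<omega>1 Y * cnj (\<omega>2 X) - \<omega>1 X * cnj (\<omega>2 Y))
          + C * (\<omega>2 Y * cnj (\<omega>1 X) - \<omega>2 X * cnj (\<omega>1 Y))))"
  have \<Phi>_inv: "\<Phi> (inv \<Phi> z) = z" for z
    using \<Phi>(2) by (simp add: bij_is_surj surj_f_inv_f)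
  have "coords \<omega>1 \<omega>2 \<omega>3 = \<Phi>"
    by (simp add: coords_def \<omega>_defs fun_eq_iff)
  moreover have "linear \<omega>1" "linear \<omega>2" "linear \<omega>3"
    using \<Phi>(1) by (auto simp: \<omega>_defs linear_add linear_scale intro!: linearI)
  moreover have "\<omega>1 (J X) = \<i> * \<omega>1 X" "\<omega>2 (J X) = \<i> * \<omega>2 X" "\<omega>3 (J X) = \<i> * \<omega>3 X" for X
    by (simp_all add: J_def \<Phi>_inv \<omega>_defs)
  ultimately have cf: "coframe10 J \<omega>1 \<omega>2 \<omega>3"
    using \<Phi>(2) by (simp add: coframe10_def forms10_def)
  have se: "structure_equations br \<omega>1 \<omega>2 \<omega>3 \<rho> B C"
    by (simp add: structure_equations_iff br_def \<Phi>_inv \<omega>_defs)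
  have cs: "complex_structure br J"
    by (rule structure_equations_complex_structure[OF cf se])
  then have "basis10 J \<omega>1 \<omega>2 \<omega>3"
    using basis10_iff_coframe10[OF dim] cf by (simp add: complex_structure_def)
  then show ?thesis
    using cs se structure_equations_nilpotent[OF cf se] unfolding admits_equations_def by blast
qed

lemma admits_equations_iff:
  fixes br :: "'a::real_vector \<Rightarrow> 'a \<Rightarrow> 'a"
  assumes dim: "dim (UNIV :: 'a set) = 6" and cs: "complex_structure br J"
  shows "admits_equations br J \<rho> B C \<longleftrightarrow>
    (\<exists>\<omega>1 \<omega>2 \<omega>3. coframe10 J \<omega>1 \<omega>2 \<omega>3 \<and> structure_equations br \<omega>1 \<omega>2 \<omega>3 \<rho> B C)"
  using basis10_iff_coframe10[OF dim] cs
  by (simp add: admits_equations_def complex_structure_def)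

section \<open>Reduction to normal form\<close>

lemma coframe10_scale:
  assumes cf: "coframe10 J \<omega>1 \<omega>2 \<omega>3" and "a \<noteq> 0" "b \<noteq> 0"
  shows "coframe10 J (\<lambda>X. a * \<omega>1 X) \<omega>2 (\<lambda>X. b * \<omega>3 X)"
proof -
  have "surj (coords (\<lambda>X. a * \<omega>1 X) \<omega>2 (\<lambda>X. b * \<omega>3 X))"
  proof (unfold surj_def, rule allI)
    fix w :: "complex \<times> complex \<times> complex"
    obtain x y z where w: "w = (x, y, z)" by (cases w)
    obtain X where "\<omega>1 X = x / a" "\<omega>2 X = y" "\<omega>3 X = z / b"
      using coframe10_obtain[OF cf] .
    then show "\<exists>X. w = coords (\<lambda>X. a * \<omega>1 X) \<omega>2 (\<lambda>X. b * \<omega>3 X) X"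
      using assms(2,3) by (auto simp: w coords_def intro!: exI[of _ X])
  qed
  moreover have "inj (coords (\<lambda>X. a * \<omega>1 X) \<omega>2 (\<lambda>X. b * \<omega>3 X))"
    by (rule injI, rule coframe10_eqI[OF cf]) (use assms(2,3) in \<open>auto simp: coords_def\<close>)
  ultimately show ?thesis
    using cf by (simp add: coframe10_def bij_def forms10_scale)
qed

text \<open>Since \<open>v * cnj v = 1\<close>, the differential of \<open>\<omega>2\<close> keeps
  its form. The factor \<open>v\<close> of the new third form is absorbed by
  \<open>\<omega>1\<close> in the first two terms. The third term contains the conjugate of
  \<open>\<omega>1\<close>, which absorbs \<open>cnj v\<close>, and
  \<open>v = v\<^sup>2 * cnj v\<close> leaves \<open>v\<^sup>2\<close>.\<close>

lemma admits_equations_rescale: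
  fixes br :: "'a::real_vector \<Rightarrow> 'a \<Rightarrow> 'a"
  assumes dim: "dim (UNIV :: 'a set) = 6" and cs: "complex_structure br J"
    and adm: "admits_equations br J \<rho> B C" and "u \<noteq> 0" "cmod v = 1"
  shows "admits_equations br J (u * \<rho>) (u * B) (u * C * v\<^sup>2)"
proof -
  obtain \<omega>1 \<omega>2 \<omega>3 where cf: "coframe10 J \<omega>1 \<omega>2 \<omega>3"
      and se: "structure_equations br \<omega>1 \<omega>2 \<omega>3 \<rho> B C"
    using adm unfolding admits_equations_iff[OF dim cs] by blast
  have v: "v * cnj v = 1"
    using \<open>cmod v = 1\<close> by (simp add: complex_norm_square[symmetric])
  then have "v \<noteq> 0" by auto
  have "coframe10 J (\<lambda>X. v * \<omega>1 X) \<omega>2 (\<lambda>X. (u * v) * \<omega>3 X)"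
    using coframe10_scale[OF cf] \<open>u \<noteq> 0\<close> \<open>v \<noteq> 0\<close> by simp
  moreover have "structure_equations br (\<lambda>X. v * \<omega>1 X) \<omega>2 (\<lambda>X. (u * v) * \<omega>3 X) (u * \<rho>) (u * B) (u * C * v\<^sup>2)"
  proof -
    have e: "v * x * (cnj v * y) = x * y" for x y
      using v by algebra
    have e': "u * C * v\<^sup>2 * (x * (cnj v * y) - z * (cnj v * w)) = u * v * (C * (x * y - z * w))" for x y z w
      using v by algebra
    show ?thesis
      unfolding structure_equations_iff complex_cnj_mult e e'
      by (simp add: structure_equationsD[OF se] algebra_simps)
  qed
  ultimately show ?thesis unfolding admits_equations_iff[OF dim cs] by blast
qed

lemma exists_rotation_to_nonneg:
  fixes C :: complex
  shows "\<exists>v. cmod v = 1 \<and> C * v\<^sup>2 = of_real (cmod C)"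
proof -
  \<comment> \<open>The argument is halved because \<open>v\<close> enters squared. For
    \<open>C = 0\<close> both sides vanish.\<close>
  have "C * (cis (- (Arg C / 2)))\<^sup>2 = of_real (cmod C) * (cis (Arg C) * cis (- (Arg C / 2)) ^ 2)"
    by (metis rcis_cmod_Arg rcis_def mult.assoc)
  also have "\<dots> = of_real (cmod C)"
    by (simp add: power2_eq_square cis_mult)
  finally show ?thesis by (intro exI[of _ "cis (- (Arg C / 2))"]) simp
qed

text \<open>Inserting \<open>J\<close> in both arguments fixes (1,1)-forms and negates (2,0)-forms,
  so the defect is exactly twice the \<open>\<rho>\<close>-term, which is nonzero on dual vectors
  unless \<open>\<rho> = 0\<close>.\<close>

lemma abelian_iff_rho_0:
  fixes br :: "'a::real_vector \<Rightarrow> 'a \<Rightarrow> 'a"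
  assumes dim: "dim (UNIV :: 'a set) = 6" and cs: "complex_structure br J"
    and adm: "admits_equations br J \<rho> B C"
  shows "abelian_complex_structure br J \<longleftrightarrow> \<rho> = 0"
proof -
  obtain \<omega>1 \<omega>2 \<omega>3 where cf: "coframe10 J \<omega>1 \<omega>2 \<omega>3"
      and se: "structure_equations br \<omega>1 \<omega>2 \<omega>3 \<rho> B C"
    using adm unfolding admits_equations_iff[OF dim cs] by blast
  have \<omega>: "\<omega>1 (J X) = \<i> * \<omega>1 X" "\<omega>2 (J X) = \<i> * \<omega>2 X" for X
    using cf by (auto simp: coframe10_def forms10_J)
  have diff: "\<omega>3 (br (J X) (J Y)) - \<omega>3 (br X Y) = 2 * \<rho> * (\<omega>1 X * \<omega>2 Y - \<omega>1 Y * \<omega>2 X)" for X Y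
    by (simp add: structure_equationsD[OF se] \<omega> algebra_simps)
  show ?thesis
  proof
    assume ab: "abelian_complex_structure br J"
    obtain X where X: "\<omega>1 X = 1" "\<omega>2 X = 0" "\<omega>3 X = 0" using coframe10_obtain[OF cf] .
    obtain Y where Y: "\<omega>1 Y = 0" "\<omega>2 Y = 1" "\<omega>3 Y = 0" using coframe10_obtain[OF cf] .
    show "\<rho> = 0"
      using diff[of X Y] ab by (simp add: abelian_complex_structure_def X Y)
  next
    assume "\<rho> = 0"
    then have "br (J X) (J Y) = br X Y" for X Y
      using diff[of X Y]
      by (intro coframe10_eqI[OF cf]) (simp_all add: structure_equationsD(1,2)[OF se] \<omega> algebra_simps)
    then show "abelian_complex_structure br J"
      using cs by (simp add: abelian_complex_structure_def)
  qed
qed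

text \<open>For \<open>\<rho> = 0\<close> the factor \<open>u\<close> makes the first nonzero entry
  among \<open>B\<close>, \<open>C\<close> equal to 1. For \<open>\<rho> = 1\<close> it must stay 1,
  and only the rotation \<open>v\<close> remains to act on \<open>C\<close>.\<close>

lemma reduction_to_normal_form:
  fixes br :: "'a::real_vector \<Rightarrow> 'a \<Rightarrow> 'a"
  assumes dim: "dim (UNIV :: 'a set) = 6" and cs: "complex_structure br J"
    and adm: "admits_equations br J \<rho> B C" and "\<rho> \<in> {0, 1}" "(\<rho>, B, C) \<noteq> (0, 0, 0)"
  shows "(abelian_complex_structure br J \<longrightarrow>
             admits_equations br J 0 0 1 \<or>
             (\<exists>c::real. c \<ge> 0 \<and> admits_equations br J 0 1 (of_real c))) \<and>
          (\<not> abelian_complex_structure br J \<longrightarrow>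
             (\<exists>(B'::complex) (c::real). c \<ge> 0 \<and> admits_equations br J 1 B' (of_real c)))"
proof -
  note rescale = admits_equations_rescale[OF dim cs adm]
  have "admits_equations br J 0 0 1" if "\<rho> = 0" "B = 0"
  proof -
    have "C \<noteq> 0" using assms(5) that by simp
    then show ?thesis using rescale[of "1 / C" 1] that by simp
  qed
  moreover have "\<exists>c::real. c \<ge> 0 \<and> admits_equations br J 0 1 (of_real c)" if "\<rho> = 0" "B \<noteq> 0"
  proof -
    obtain v where "cmod v = 1" "C / B * v\<^sup>2 = of_real (cmod (C / B))"
      using exists_rotation_to_nonneg by blast
    then have "admits_equations br J 0 1 (of_real (cmod (C / B)))"
      using rescale[of "1 / B" v] that by simp
    then show ?thesis using norm_ge_zero by blast
  qed
  moreover have "\<exists>B' (c::real). c \<ge> 0 \<and> admits_equations br J 1 B' (of_real c)" if "\<rho> = 1"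
  proof -
    obtain v where "cmod v = 1" "C * v\<^sup>2 = of_real (cmod C)"
      using exists_rotation_to_nonneg by blast
    then have "admits_equations br J 1 B (of_real (cmod C))"
      using rescale[of 1 v] that by simp
    then show ?thesis using norm_ge_zero by blast
  qed
  ultimately show ?thesis
    using abelian_iff_rho_0[OF dim cs adm] assms(4) by blast
qed

section \<open>Uniqueness of the normal form\<close>

text \<open>This linear independence is what allows coefficients to be compared after a change of
  coframe.\<close>

lemma two_forms_independent:
  assumes cf: "coframe10 J \<omega>1 \<omega>2 \<omega>3"
    and eq: "\<And>X Y. t * (\<omega>1 Y * cnj (\<omega>1 X) - \<omega>1 X * cnj (\<omega>1 Y))
          + \<rho> * (\<omega>1 Y * \<omega>2 X - \<omega>1 X * \<omega>2 Y)
          + B * (\<omega>1 Y * cnj (\<omega>2 X) - \<omega>1 X * cnj (\<omega>2 Y))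
          + C * (\<omega>2 Y * cnj (\<omega>1 X) - \<omega>2 X * cnj (\<omega>1 Y)) = 0"
  shows "t = 0 \<and> \<rho> = 0 \<and> B = 0 \<and> C = 0"
proof -
  \<comment> \<open>Multiples by \<open>\<i>\<close> are needed because conjugate terms agree with
    unconjugated ones on real coordinates. The pair \<open>X1\<close>, \<open>X2\<close> isolates
    \<open>t\<close>; three mixed pairs determine the other coefficients.\<close>
  obtain X1 where X1: "\<omega>1 X1 = 1" "\<omega>2 X1 = 0" "\<omega>3 X1 = 0" using coframe10_obtain[OF cf] .
  obtain X2 where X2: "\<omega>1 X2 = \<i>" "\<omega>2 X2 = 0" "\<omega>3 X2 = 0" using coframe10_obtain[OF cf] .
  obtain Y1 where Y1: "\<omega>1 Y1 = 0" "\<omega>2 Y1 = 1" "\<omega>3 Y1 = 0" using coframe10_obtain[OF cf] .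
  obtain Y2 where Y2: "\<omega>1 Y2 = 0" "\<omega>2 Y2 = \<i>" "\<omega>3 Y2 = 0" using coframe10_obtain[OF cf] .
  have ii: "\<i> * \<i> = -1" by simp
  have e: "- \<rho> - B + C = 0" "- \<rho> * \<i> + B * \<i> + C * \<i> = 0" "- \<rho> * \<i> - B * \<i> - C * \<i> = 0"
    using eq[where X = X1 and Y = Y1] eq[where X = X1 and Y = Y2] eq[where X = X2 and Y = Y1]
    by (simp_all add: X1 X2 Y1 Y2 mult.commute)
  have "t = 0" using eq[where X = X1 and Y = X2] by (simp add: X1 X2)
  moreover have "\<rho> = 0 \<and> B = 0 \<and> C = 0"
    using e ii by algebra
  ultimately show ?thesis by blast
qed

lemma forms10_expand:
  fixes J :: "'a::real_vector \<Rightarrow> 'a"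
  assumes dim: "dim (UNIV :: 'a set) = 6" and J: "linear J" "\<And>X. J (J X) = - X"
    and cf: "coframe10 J \<omega>1 \<omega>2 \<omega>3" and "\<alpha> \<in> forms10 J"
  shows "\<exists>a b c. \<forall>X. \<alpha> X = a * \<omega>1 X + b * \<omega>2 X + c * \<omega>3 X"
proof -
  have "basis10 J \<omega>1 \<omega>2 \<omega>3"
    using basis10_iff_coframe10[OF dim J] cf by simp
  then have "\<alpha> \<in> forms.span {\<omega>1, \<omega>2, \<omega>3}"
    using \<open>\<alpha> \<in> forms10 J\<close> by (simp add: basis10_def)
  then obtain a b c where "\<alpha> = (\<lambda>X. a * \<omega>1 X + b * \<omega>2 X + c * \<omega>3 X)"
    using forms_span_three by metis
  then show ?thesis by auto
qed

text \<open>The differentials force the change of coframe to be triangular, with diagonal entries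
  \<open>a\<close>, \<open>a * cnj a\<close> and a nonzero third one. The third relation carries
  \<open>cnj a\<close> because \<open>C\<close> multiplies a term containing the conjugate of
  \<open>\<omega>1\<close>.\<close>

lemma change_of_coframe:
  fixes br :: "'a::real_vector \<Rightarrow> 'a \<Rightarrow> 'a"
  assumes dim: "dim (UNIV :: 'a set) = 6" and cs: "complex_structure br J"
    and adm: "admits_equations br J \<rho> B C" and adm': "admits_equations br J \<rho>' B' C'"
    and nz: "(\<rho>, B, C) \<noteq> (0, 0, 0)"
  shows "\<exists>a u. a \<noteq> 0 \<and> u \<noteq> 0 \<and> u * \<rho> = a * \<rho>' \<and> u * B = a * B' \<and> u * C = cnj a * C'"
proof -
  obtain \<omega>1 \<omega>2 \<omega>3 where cf: "coframe10 J \<omega>1 \<omega>2 \<omega>3"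
      and se: "structure_equations br \<omega>1 \<omega>2 \<omega>3 \<rho> B C"
    using adm unfolding admits_equations_iff[OF dim cs] by blast
  obtain \<sigma>1 \<sigma>2 \<sigma>3 where cf': "coframe10 J \<sigma>1 \<sigma>2 \<sigma>3"
      and se': "structure_equations br \<sigma>1 \<sigma>2 \<sigma>3 \<rho>' B' C'"
    using adm' unfolding admits_equations_iff[OF dim cs] by blast
  have \<sigma>: "\<sigma>1 \<in> forms10 J" "\<sigma>2 \<in> forms10 J" "\<sigma>3 \<in> forms10 J"
    using cf' by (auto simp: coframe10_def)
  have J: "linear J" "\<And>X. J (J X) = - X"
    using cs by (auto simp: complex_structure_def)
  note expand = forms10_expand[OF dim J cf]
  note br = structure_equationsD[OF se]
  note br' = structure_equationsD[OF se']

  obtain a b c where s1: "\<And>X. \<sigma>1 X = a * \<omega>1 X + b * \<omega>2 X + c * \<omega>3 X"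
    using expand[OF \<sigma>(1)] by blast
  \<comment> \<open>\<open>\<sigma>1\<close> is closed; as some coefficient of the differential of
    \<open>\<omega>3\<close> is nonzero, neither \<open>\<omega>2\<close> nor
    \<open>\<omega>3\<close> can occur in it.\<close>
  have "b = 0 \<and> c * \<rho> = 0 \<and> c * B = 0 \<and> c * C = 0"
  proof (rule two_forms_independent[OF cf], goal_cases)
    case (1 X Y)
    show ?case using br'(1)[of X Y] by (simp add: s1 br algebra_simps)
  qed
  with nz have "b = 0" "c = 0" by auto
  with s1 have s1: "\<And>X. \<sigma>1 X = a * \<omega>1 X" by simp
  obtain X where "\<sigma>1 X = 1" using coframe10_obtain[OF cf'] .
  then have "a \<noteq> 0" using s1[of X] by auto

  obtain p q r where s2: "\<And>X. \<sigma>2 X = p * \<omega>1 X + q * \<omega>2 X + r * \<omega>3 X"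
    using expand[OF \<sigma>(2)] by blast
  have "q - a * cnj a = 0 \<and> r * \<rho> = 0 \<and> r * B = 0 \<and> r * C = 0"
  proof (rule two_forms_independent[OF cf], goal_cases)
    case (1 X Y)
    show ?case using br'(2)[of X Y] by (simp add: s1 s2 br algebra_simps)
  qed
  with nz have q: "q = a * cnj a" and "r = 0" by auto
  with s2 have s2: "\<And>X. \<sigma>2 X = p * \<omega>1 X + a * cnj a * \<omega>2 X" by simp

  obtain s t u where s3: "\<And>X. \<sigma>3 X = s * \<omega>1 X + t * \<omega>2 X + u * \<omega>3 X"
    using expand[OF \<sigma>(3)] by blast
  \<comment> \<open>The off-diagonal coefficient \<open>p\<close> enters only the first equation,
    which fixes \<open>t\<close>. The other three carry a common factor \<open>a * cnj a\<close>,
    divided out at the end.\<close>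
  have "t - B' * a * cnj p - C' * cnj a * p = 0 \<and> u * \<rho> - a * (a * cnj a) * \<rho>' = 0 \<and>
      u * B - a * (a * cnj a) * B' = 0 \<and> u * C - cnj a * (a * cnj a) * C' = 0"
  proof (rule two_forms_independent[OF cf], goal_cases)
    case (1 X Y)
    show ?case using br'(3)[of X Y] by (simp add: s1 s2 s3 br algebra_simps)
  qed
  moreover have "u \<noteq> 0"
  proof
    \<comment> \<open>Vanishing \<open>\<sigma>1\<close> and \<open>\<sigma>2\<close> force
      \<open>\<omega>1\<close> and \<open>\<omega>2\<close> to vanish, so \<open>\<sigma>3\<close>
      would be 0 there as well.\<close>
    assume "u = 0"
    obtain X where "\<sigma>1 X = 0" "\<sigma>2 X = 0" "\<sigma>3 X = 1" using coframe10_obtain[OF cf'] .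
    then show False using \<open>a \<noteq> 0\<close> \<open>u = 0\<close> by (simp add: s1 s2 s3)
  qed
  moreover have "u / (a * cnj a) * x = z * y" if "u * x - z * (a * cnj a) * y = 0" for x y z
    using that \<open>a \<noteq> 0\<close> by (simp add: divide_eq_eq ac_simps)
  ultimately show ?thesis
    using \<open>a \<noteq> 0\<close> by (intro exI[of _ a] exI[of _ "u / (a * cnj a)"]) (simp del: times_divide_eq_left)
qed

lemma normal_form_unique:
  fixes br :: "'a::real_vector \<Rightarrow> 'a \<Rightarrow> 'a"
  assumes dim: "dim (UNIV :: 'a set) = 6" and cs: "complex_structure br J"
    and adm: "admits_equations br J \<rho> B C" and adm': "admits_equations br J \<rho>' B' C'"
    and nf: "(\<rho>, B, C) \<in> normal_forms" and nf': "(\<rho>', B', C') \<in> normal_forms"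
  shows "(\<rho>, B, C) = (\<rho>', B', C')"
proof -
  have "(\<rho>, B, C) \<noteq> (0, 0, 0)" using nf by (auto simp: normal_forms_def)
  then obtain a u where au: "a \<noteq> 0" "u \<noteq> 0" and e: "u * \<rho> = a * \<rho>'" "u * B = a * B'" "u * C = cnj a * C'"
    using change_of_coframe[OF dim cs adm adm'] by blast
  \<comment> \<open>A common entry 1 in the first or second place gives \<open>u = a\<close>;
    nonnegative reals \<open>C\<close> and \<open>C'\<close> of equal modulus then coincide. An
    entry 1 facing 0 would contradict \<open>a\<close> and \<open>u\<close> being nonzero.\<close>
  have "u = a \<Longrightarrow> cmod C = cmod C'"
    using e(3) au(1) by (metis complex_mod_cnj mult_left_cancel norm_eq_zero norm_mult)
  then show ?thesis
    using nf nf' e au by (auto simp: normal_forms_def)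
qed

section \<open>Equivalence and equality of coefficients\<close>

text \<open>Composing forms with the isomorphism preserves type and equations. This brings both
  coefficient triples onto one algebra, where \<open>normal_form_unique\<close> applies.\<close>

lemma admits_equations_pullback:
  fixes br :: "'a::real_vector \<Rightarrow> 'a \<Rightarrow> 'a" and br' :: "'b::real_vector \<Rightarrow> 'b \<Rightarrow> 'b"
  assumes dim_a: "dim (UNIV :: 'a set) = 6" and dim_b: "dim (UNIV :: 'b set) = 6"
    and cs: "complex_structure br J" and cs': "complex_structure br' J'"
    and eqv: "equivalent_complex_structures br J br' J'"
    and adm': "admits_equations br' J' \<rho> B C"
  shows "admits_equations br J \<rho> B C"
proof -
  obtain F where F: "linear F" "bij F" "\<And>X Y. F (br X Y) = br' (F X) (F Y)" "F \<circ> J = J' \<circ> F"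
    using eqv unfolding equivalent_complex_structures_def by blast
  obtain \<sigma>1 \<sigma>2 \<sigma>3 where cf': "coframe10 J' \<sigma>1 \<sigma>2 \<sigma>3"
      and se': "structure_equations br' \<sigma>1 \<sigma>2 \<sigma>3 \<rho> B C"
    using adm' unfolding admits_equations_iff[OF dim_b cs'] by blast
  have "\<alpha> \<circ> F \<in> forms10 J" if "\<alpha> \<in> forms10 J'" for \<alpha>
    using that F(1,4) by (auto simp: forms10_def fun_eq_iff intro: linear_compose)
  moreover have "coords (\<sigma>1 \<circ> F) (\<sigma>2 \<circ> F) (\<sigma>3 \<circ> F) = coords \<sigma>1 \<sigma>2 \<sigma>3 \<circ> F"
    by (simp add: coords_def fun_eq_iff)
  ultimately have "coframe10 J (\<sigma>1 \<circ> F) (\<sigma>2 \<circ> F) (\<sigma>3 \<circ> F)"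
    using cf' F(2) by (simp add: coframe10_def bij_comp)
  moreover have "structure_equations br (\<sigma>1 \<circ> F) (\<sigma>2 \<circ> F) (\<sigma>3 \<circ> F) \<rho> B C"
    using se' by (simp add: structure_equations_iff F(3))
  ultimately show ?thesis unfolding admits_equations_iff[OF dim_a cs] by blast
qed

text \<open>Matching coordinates defines the isomorphism: bracket and \<open>J\<close> are given by
  the same formulas in either coframe.\<close>

lemma equivalent_if_same_equations:
  fixes br :: "'a::real_vector \<Rightarrow> 'a \<Rightarrow> 'a" and br' :: "'b::real_vector \<Rightarrow> 'b \<Rightarrow> 'b"
  assumes dim_a: "dim (UNIV :: 'a set) = 6" and dim_b: "dim (UNIV :: 'b set) = 6"
    and cs: "complex_structure br J" and cs': "complex_structure br' J'"
    and adm: "admits_equations br J \<rho> B C" and adm': "admits_equations br' J' \<rho> B C"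
  shows "equivalent_complex_structures br J br' J'"
proof -
  obtain \<omega>1 \<omega>2 \<omega>3 where cf: "coframe10 J \<omega>1 \<omega>2 \<omega>3"
      and se: "structure_equations br \<omega>1 \<omega>2 \<omega>3 \<rho> B C"
    using adm unfolding admits_equations_iff[OF dim_a cs] by blast
  obtain \<sigma>1 \<sigma>2 \<sigma>3 where cf': "coframe10 J' \<sigma>1 \<sigma>2 \<sigma>3"
      and se': "structure_equations br' \<sigma>1 \<sigma>2 \<sigma>3 \<rho> B C"
    using adm' unfolding admits_equations_iff[OF dim_b cs'] by blast
  have \<omega>: "\<omega>1 \<in> forms10 J" "\<omega>2 \<in> forms10 J" "\<omega>3 \<in> forms10 J"
    and \<sigma>: "\<sigma>1 \<in> forms10 J'" "\<sigma>2 \<in> forms10 J'" "\<sigma>3 \<in> forms10 J'"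
    and bij: "bij (coords \<omega>1 \<omega>2 \<omega>3)" and bij': "bij (coords \<sigma>1 \<sigma>2 \<sigma>3)"
    using cf cf' by (auto simp: coframe10_def)
  define F where "F = inv (coords \<sigma>1 \<sigma>2 \<sigma>3) \<circ> coords \<omega>1 \<omega>2 \<omega>3"
  have "coords \<sigma>1 \<sigma>2 \<sigma>3 (F X) = coords \<omega>1 \<omega>2 \<omega>3 X" for X
    using bij' by (simp add: F_def bij_is_surj surj_f_inv_f)
  then have F: "\<sigma>1 (F X) = \<omega>1 X" "\<sigma>2 (F X) = \<omega>2 X" "\<sigma>3 (F X) = \<omega>3 X" for X
    by (simp_all add: coords_def)
  note lin = \<omega>[THEN forms10_linear] \<sigma>[THEN forms10_linear]
  have "bij F" unfolding F_def using bij bij' by (simp add: bij_comp bij_imp_bij_inv)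
  moreover have "linear F"
    using lin by (auto intro!: linearI coframe10_eqI[OF cf'] simp: F linear_add linear_scale)
  moreover have "F (br X Y) = br' (F X) (F Y)" for X Y
    by (rule coframe10_eqI[OF cf']) (use se se' in \<open>simp_all add: structure_equations_iff F\<close>)
  moreover have "F (J X) = J' (F X)" for X
    by (rule coframe10_eqI[OF cf'])
      (simp_all add: F \<omega>[THEN forms10_J] \<sigma>[THEN forms10_J])
  ultimately show ?thesis
    unfolding equivalent_complex_structures_def by (intro exI[of _ F]) (auto simp: fun_eq_iff)
qed

section \<open>Assembling reduction, realisation and classification\<close>

theorem lemma2p14:
  assumes dim_a: "dim (UNIV :: 'a::real_vector set) = 6"
    and dim_b: "dim (UNIV :: 'b::real_vector set) = 6"
  shows
    "(\<forall>(br :: 'a \<Rightarrow> 'a \<Rightarrow> 'a) J \<rho> B C.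
        nilpotent_lie_bracket br \<and> complex_structure br J \<and>
        \<rho> \<in> {0, 1} \<and> (\<rho>, B, C) \<noteq> (0, 0, 0) \<and> admits_equations br J \<rho> B C \<longrightarrow>
          (abelian_complex_structure br J \<longrightarrow>
             admits_equations br J 0 0 1 \<or>
             (\<exists>c::real. c \<ge> 0 \<and> admits_equations br J 0 1 (of_real c))) \<and>
          (\<not> abelian_complex_structure br J \<longrightarrow>
             (\<exists>(B'::complex) (c::real). c \<ge> 0 \<and> admits_equations br J 1 B' (of_real c))))
     \<and>
     (\<forall>(\<rho>, B, C) \<in> normal_forms.
        \<exists>(br :: 'a \<Rightarrow> 'a \<Rightarrow> 'a) J.
          nilpotent_lie_bracket br \<and> complex_structure br J \<and> admits_equations br J \<rho> B C)
     \<and>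
     (\<forall>(\<rho>, B, C) \<in> normal_forms. \<forall>(\<rho>', B', C') \<in> normal_forms.
        \<forall>(br :: 'a \<Rightarrow> 'a \<Rightarrow> 'a) J (br' :: 'b \<Rightarrow> 'b \<Rightarrow> 'b) J'.
          nilpotent_lie_bracket br \<and> complex_structure br J \<and> admits_equations br J \<rho> B C \<and>
          nilpotent_lie_bracket br' \<and> complex_structure br' J' \<and> admits_equations br' J' \<rho>' B' C' \<longrightarrow>
            (equivalent_complex_structures br J br' J' \<longleftrightarrow> (\<rho>, B, C) = (\<rho>', B', C')))"
proof (intro conjI)
  show "\<forall>(\<rho>, B, C) \<in> normal_forms.
        \<exists>(br :: 'a \<Rightarrow> 'a \<Rightarrow> 'a) J.
          nilpotent_lie_bracket br \<and> complex_structure br J \<and> admits_equations br J \<rho> B C"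
    using exists_complex_structure_admitting[OF dim_a] by auto
next
  show "\<forall>(\<rho>, B, C) \<in> normal_forms. \<forall>(\<rho>', B', C') \<in> normal_forms.
        \<forall>(br :: 'a \<Rightarrow> 'a \<Rightarrow> 'a) J (br' :: 'b \<Rightarrow> 'b \<Rightarrow> 'b) J'.
          nilpotent_lie_bracket br \<and> complex_structure br J \<and> admits_equations br J \<rho> B C \<and>
          nilpotent_lie_bracket br' \<and> complex_structure br' J' \<and> admits_equations br' J' \<rho>' B' C' \<longrightarrow>
            (equivalent_complex_structures br J br' J' \<longleftrightarrow> (\<rho>, B, C) = (\<rho>', B', C'))"
  proof -
    have "equivalent_complex_structures br J br' J' \<longleftrightarrow> (\<rho>, B, C) = (\<rho>', B', C')"
      if nf: "(\<rho>, B, C) \<in> normal_forms" "(\<rho>', B', C') \<in> normal_forms"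
        and cs: "complex_structure br J" "complex_structure br' J'"
        and adm: "admits_equations br J \<rho> B C" "admits_equations br' J' \<rho>' B' C'"
      for \<rho> B C \<rho>' B' C' J J' and br :: "'a \<Rightarrow> 'a \<Rightarrow> 'a" and br' :: "'b \<Rightarrow> 'b \<Rightarrow> 'b"
    proof
      assume "equivalent_complex_structures br J br' J'"
      then have "admits_equations br J \<rho>' B' C'"
        using admits_equations_pullback[OF dim_a dim_b cs] adm(2) by blast
      then show "(\<rho>, B, C) = (\<rho>', B', C')"
        using normal_form_unique[OF dim_a cs(1) adm(1)] nf by blast
    next
      assume "(\<rho>, B, C) = (\<rho>', B', C')"
      then show "equivalent_complex_structures br J br' J'"
        using equivalent_if_same_equations[OF dim_a dim_b cs adm(1)] adm(2) by simp
    qed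
    then show ?thesis by fast
  qed
qed (use reduction_to_normal_form[OF dim_a] in blast)

end
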